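(* Let $m\ge 1$ be an odd integer. The CK-extension of the Gaussian distribution $\exp(-|\underline x|^2/2)$ in $\mathbb R^m$ is given, for $x=x_0+\underline x\in\mathbb R^{m+1}$, by \[\mathsf{CK}\left[\exp(-|\underline x|^2/2)\right](x)=(-1)^{\frac{m-1}{2}}\,\frac{\mathsf{Ft}\left[\exp(z^2/2),1\right](x)}{(m-1)!!}\qquad\text{for }\underline x\neq 0,\] and \[\mathsf{CK}\left[\exp(-|\underline x|^2/2)\right](x)=\exp(x_0^2/2)\left(1+\sum_{n=1}^{\frac{m-1}{2}}\;\prod_{\nu=1}^n\bigl(m-(2\nu-1)\bigr)\,\frac{x_0^{2n}}{(2n)!}\right)\qquad\text{for }\underline x=0.\]
   Context: $\mathbb R_{0,m}$ is the real Clifford algebra (associative, unital, of dimension $2^m$) generated by an orthonormal basis $e_1,\dots,e_m$ of $\mathbb R^m$ with $e_j^2=-1$ and $e_je_k+e_ke_j=0$ for $j\neq k$. A point $(x_1,\dots,x_m)\in\mathbb R^m$ is identified with $\underline x=\sum_{j=1}^m x_je_j$, and $(x_0,x_1,\dots,x_m)\in\mathbb R^{m+1}$ with the paravector $x=x_0+\underline x\in\mathbb R_{0,m}$. Put $r=|\underline x|=\left(\sum_{j=1}^m x_j^2\right)^{1/2}$ and $\underline\omega=\underline x/r$ for $\underline x\neq 0$. The Dirac operator is $\partial_{\underline x}=\sum_{j=1}^m e_j\partial_{x_j}$, the generalized Cauchy-Riemann operator is $\partial_x=\partial_{x_0}+\partial_{\underline x}$ (both acting from the left), and $\Delta_x=\sum_{j=0}^m\partial_{x_j}^2$.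 A continuously differentiable $\mathbb R_{0,m}$-valued function $f$ on an open subset of $\mathbb R^{m+1}$ is (left) monogenic if $\partial_xf=0$ there. For an analytic function $g(\underline x)$ in $\mathbb R^m$, its CK-extension (Cauchy-Kowalevski extension) is the unique monogenic extension of $g$ to $\mathbb R^{m+1}$ (extension from the hyperplane $x_0=0$), given by \[\mathsf{CK}[g](x)=\sum_{n=0}^\infty\frac{(-x_0)^n}{n!}\,\partial_{\underline x}^n g(\underline x).\] For $m$ odd and $f(z)=u(x,y)+iv(x,y)$ ($z=x+iy$, with $u,v$ real-valued) holomorphic in the upper half-plane $\{y>0\}$, define, for $x\in\mathbb R^{m+1}$ with $\underline x\neq0$, \[\mathsf{Ft}\left[f(z),1\right](x)=\Delta_x^{\frac{m-1}{2}}\bigl[u(x_0,r)+\underline\omega\,v(x_0,r)\bigr].\] In particular, for $f(z)=\exp(z^2/2)$ one has $u(x,y)=\exp\left(\frac{x^2-y^2}{2}\right)\cos(xy)$ and $v(x,y)=\exp\left(\frac{x^2-y^2}{2}\right)\sin(xy)$. $n!!$ denotes the double factorial, with $0!!=1$; an empty sum is $0$. *)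

theory Defs
  imports "HOL-Analysis.Analysis"
begin

section \<open>The real Clifford algebra of signature (0, m)\<close>

text \<open>
  The index type \<open>'n\<close> plays the role of \<open>{1, ..., m}\<close>, with \<open>m = CARD('n)\<close>. An element is given
  by its coefficients with respect to the basis of ordered products
  \<open>e\<^sub>A = e\<^bsub>i1\<^esub> ... e\<^bsub>ik\<^esub>\<close> for \<open>A = {i1 < ... < ik}\<close>.
\<close>

typedef 'n clifford = "UNIV :: ('n set \<Rightarrow> real) set"
  morphisms coef Clifford ..

setup_lifting type_definition_clifford

lemma clifford_eq_iff: "x = y \<longleftrightarrow> (\<forall>A. coef x A = coef y A)"
  by (metis coef_inject ext)

instantiation clifford :: (type) real_vector
begin

lift_definition zero_clifford :: "'a clifford" is "\<lambda>_. 0" .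
lift_definition plus_clifford :: "'a clifford \<Rightarrow> 'a clifford \<Rightarrow> 'a clifford"
  is "\<lambda>x y A. x A + y A" .
lift_definition minus_clifford :: "'a clifford \<Rightarrow> 'a clifford \<Rightarrow> 'a clifford"
  is "\<lambda>x y A. x A - y A" .
lift_definition uminus_clifford :: "'a clifford \<Rightarrow> 'a clifford" is "\<lambda>x A. - x A" .
lift_definition scaleR_clifford :: "real \<Rightarrow> 'a clifford \<Rightarrow> 'a clifford"
  is "\<lambda>r x A. r * x A" .

instance
  by standard (transfer; simp add: fun_eq_iff algebra_simps)+

end

lemma coef_simps [simp]:
  "coef 0 A = 0" "coef (x + y) A = coef x A + coef y A" "coef (x - y) A = coef x A - coef y A"
  "coef (- x) A = - coef x A" "coef (r *\<^sub>R x) A = r * coef x A"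
  by (transfer; simp)+

instantiation clifford :: (finite) real_inner
begin

definition inner_clifford :: "'a clifford \<Rightarrow> 'a clifford \<Rightarrow> real"
  where "inner_clifford x y = (\<Sum>A\<in>UNIV. coef x A * coef y A)"
definition norm_clifford :: "'a clifford \<Rightarrow> real"
  where "norm_clifford x = sqrt (inner x x)"
definition sgn_clifford :: "'a clifford \<Rightarrow> 'a clifford"
  where "sgn_clifford x = x /\<^sub>R norm x"
definition dist_clifford :: "'a clifford \<Rightarrow> 'a clifford \<Rightarrow> real"
  where "dist_clifford x y = norm (x - y)"
definition uniformity_clifford :: "('a clifford \<times> 'a clifford) filter"
  where "uniformity_clifford = (INF e\<in>{0<..}. principal {(x, y). dist x y < e})"
definition open_clifford :: "'a clifford set \<Rightarrow> bool"
  where "open_clifford U \<longleftrightarrow>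
    (\<forall>x\<in>U. eventually (\<lambda>(x', y). x' = x \<longrightarrow> y \<in> U) uniformity)"

instance
proof
  fix x y z :: "'a clifford" and r :: real
  show "inner x y = inner y x" by (simp add: inner_clifford_def mult.commute)
  show "inner (x + y) z = inner x z + inner y z"
    by (simp add: inner_clifford_def sum.distrib algebra_simps)
  show "inner (scaleR r x) y = r * inner x y"
    by (simp add: inner_clifford_def sum_distrib_left algebra_simps)
  show "0 \<le> inner x x" by (simp add: inner_clifford_def sum_nonneg)
  show "inner x x = 0 \<longleftrightarrow> x = 0"
    by (simp add: inner_clifford_def sum_nonneg_eq_0_iff clifford_eq_iff)
qed (simp_all only: norm_clifford_def sgn_clifford_def dist_clifford_def
      uniformity_clifford_def open_clifford_def)

end

lift_definition cbasis :: "'n set \<Rightarrow> 'n clifford" is "\<lambda>A B. if A = B then 1 else 0" .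

lemma coef_cbasis [simp]: "coef (cbasis A) B = (if A = B then 1 else 0)"
  by transfer simp

lemma inner_cbasis: "inner x (cbasis A) = coef x A"
proof -
  have "inner x (cbasis A) = (\<Sum>B\<in>UNIV. if A = B then coef x B else 0)"
    unfolding inner_clifford_def by (rule sum.cong) auto
  then show ?thesis by simp
qed

instantiation clifford :: (finite) euclidean_space
begin

definition Basis_clifford :: "'a clifford set" where "Basis_clifford = range cbasis"

instance
proof
  fix u v x :: "'a clifford"
  show "(Basis :: 'a clifford set) \<noteq> {}" "finite (Basis :: 'a clifford set)"
    by (simp_all add: Basis_clifford_def)
  show "inner u v = (if u = v then 1 else 0)" if "u \<in> Basis" "v \<in> Basis"
    using that by (auto simp: Basis_clifford_def inner_cbasis clifford_eq_iff)
  show "(\<forall>u\<in>Basis. inner x u = 0) \<longleftrightarrow> x = 0"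
    by (simp add: Basis_clifford_def inner_cbasis clifford_eq_iff)
qed

end

text \<open>
  \<open>e\<^sub>A e\<^sub>B = reorder_sign A B \<cdot> e\<^bsub>A \<triangle> B\<^esub>\<close>: each pair \<open>(a, b) \<in> A \<times> B\<close> with \<open>a > b\<close> contributes one
  transposition and each pair with \<open>a = b\<close> one factor \<open>e\<^sub>a\<^sup>2 = -1\<close>.
\<close>

definition reorder_sign :: "'n::{finite,linorder} set \<Rightarrow> 'n set \<Rightarrow> real"
  where "reorder_sign A B = (\<Prod>a\<in>A. \<Prod>b\<in>B. if b \<le> a then - 1 else 1)"

lemma prod_sym_diff:
  fixes f :: "'n::finite \<Rightarrow> real"
  assumes "\<And>a. f a * f a = 1"
  shows "prod f (sym_diff A B) = prod f A * prod f B"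
proof -
  have 1: "prod f C * prod f C = 1" for C
    by (simp add: prod.distrib [symmetric] assms)
  have A: "prod f A = prod f (A - B) * prod f (A \<inter> B)"
    by (subst prod.union_disjoint [symmetric]) (auto intro!: prod.cong)
  have B: "prod f B = prod f (B - A) * prod f (A \<inter> B)"
    by (subst prod.union_disjoint [symmetric]) (auto intro!: prod.cong)
  have "prod f (sym_diff A B) = prod f (A - B) * prod f (B - A)"
    by (subst prod.union_disjoint) auto
  also have "\<dots> = prod f (A - B) * prod f (B - A) * (prod f (A \<inter> B) * prod f (A \<inter> B))"
    by (simp add: 1)
  finally show ?thesis by (simp add: A B mult_ac)
qed

lemma reorder_sign_left:
  "reorder_sign (sym_diff A B) C = reorder_sign A C * reorder_sign B C"
  unfolding reorder_sign_def
  by (rule prod_sym_diff) (auto simp: prod.distrib [symmetric] intro!: prod.neutral)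

lemma reorder_sign_right:
  "reorder_sign A (sym_diff B C) = reorder_sign A B * reorder_sign A C"
  unfolding reorder_sign_def prod.distrib [symmetric]
  by (rule prod.cong [OF refl], rule prod_sym_diff) simp

lemma reorder_sign_empty [simp]: "reorder_sign {} A = 1" "reorder_sign A {} = 1"
  by (simp_all add: reorder_sign_def)

lemma bij_sym_diff: "bij (sym_diff A)"
  by (rule o_bij [where g = "sym_diff A"]) (auto simp: fun_eq_iff)

instantiation clifford :: ("{finite, linorder}") real_algebra_1
begin

lift_definition one_clifford :: "'a clifford" is "\<lambda>A. if A = {} then 1 else 0" .

lift_definition times_clifford :: "'a clifford \<Rightarrow> 'a clifford \<Rightarrow> 'a clifford"
  is "\<lambda>x y C. \<Sum>A\<in>UNIV. reorder_sign A (sym_diff A C) * x A * y (sym_diff A C)" .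

instance
proof
  have coef_mult: "coef (x * y) C =
      (\<Sum>A\<in>UNIV. reorder_sign A (sym_diff A C) * coef x A * coef y (sym_diff A C))"
    for x y :: "'a clifford" and C
    by transfer simp
  have coef_1: "coef (1 :: 'a clifford) C = (if C = {} then 1 else 0)" for C
    by transfer simp
  fix a b c :: "'a clifford" and r :: real
  show "a * b * c = a * (b * c)"
  proof (unfold clifford_eq_iff, rule allI)
    fix D
    have "coef (a * b * c) D = (\<Sum>E\<in>UNIV. \<Sum>A\<in>UNIV. reorder_sign E (sym_diff E D) *
        (reorder_sign A (sym_diff A E) * coef a A * coef b (sym_diff A E)) * coef c (sym_diff E D))"
      by (simp add: coef_mult sum_distrib_left sum_distrib_right)
    also have "\<dots> = (\<Sum>A\<in>UNIV. \<Sum>E\<in>UNIV. reorder_sign E (sym_diff E D) *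
        (reorder_sign A (sym_diff A E) * coef a A * coef b (sym_diff A E)) * coef c (sym_diff E D))"
      by (rule sum.swap)
    also have "\<dots> = (\<Sum>A\<in>UNIV. \<Sum>B\<in>UNIV. reorder_sign A (sym_diff A D) * coef a A *
        (reorder_sign B (sym_diff B (sym_diff A D)) * coef b B *
           coef c (sym_diff B (sym_diff A D))))"
    proof (rule sum.cong [OF refl])
      fix A :: "'a set"
      show "(\<Sum>E\<in>UNIV. reorder_sign E (sym_diff E D) *
          (reorder_sign A (sym_diff A E) * coef a A * coef b (sym_diff A E)) *
           coef c (sym_diff E D)) =
        (\<Sum>B\<in>UNIV. reorder_sign A (sym_diff A D) * coef a A *
          (reorder_sign B (sym_diff B (sym_diff A D)) * coef b B *
           coef c (sym_diff B (sym_diff A D))))"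
      proof (subst sum.reindex_bij_betw [OF bij_sym_diff [of A], symmetric], rule sum.cong [OF refl])
        fix B :: "'a set"
        have s1: "sym_diff A (sym_diff A B) = B"
          and s2: "sym_diff (sym_diff A B) D = sym_diff B (sym_diff A D)"
          by auto
        define F where "F = sym_diff B (sym_diff A D)"
        have AD: "sym_diff A D = sym_diff B F"
          by (auto simp: F_def)
        show "reorder_sign (sym_diff A B) (sym_diff (sym_diff A B) D) *
          (reorder_sign A (sym_diff A (sym_diff A B)) * coef a A *
           coef b (sym_diff A (sym_diff A B))) * coef c (sym_diff (sym_diff A B) D) =
          reorder_sign A (sym_diff A D) * coef a A *
          (reorder_sign B (sym_diff B (sym_diff A D)) * coef b B *
           coef c (sym_diff B (sym_diff A D)))"
          unfolding s1 s2 F_def [symmetric] reorder_sign_left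
          by (simp only: AD reorder_sign_right) (simp only: mult_ac)
      qed
    qed
    also have "\<dots> = coef (a * (b * c)) D"
      by (simp add: coef_mult sum_distrib_left)
    finally show "coef (a * b * c) D = coef (a * (b * c)) D" .
  qed
  show "1 * a = a"
  proof (unfold clifford_eq_iff, rule allI)
    fix C
    have "coef (1 * a) C = (\<Sum>A\<in>(UNIV :: 'a set set). if A = {} then coef a C else 0)"
      unfolding coef_mult by (rule sum.cong) (auto simp: coef_1)
    then show "coef (1 * a) C = coef a C" by simp
  qed
  show "a * 1 = a"
  proof (unfold clifford_eq_iff, rule allI)
    fix C :: "'a set"
    have "sym_diff A C = {} \<longleftrightarrow> A = C" for A by auto
    then have "coef (a * 1) C = (\<Sum>A\<in>UNIV. if A = C then coef a C else 0)"
      unfolding coef_mult coef_1 by (intro sum.cong) (simp_all del: Un_empty)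
    then show "coef (a * 1) C = coef a C" by simp
  qed
  show "(a + b) * c = a * c + b * c" "a * (b + c) = a * b + a * c"
    by (simp_all add: clifford_eq_iff coef_mult sum.distrib distrib_left distrib_right)
  show "r *\<^sub>R a * b = r *\<^sub>R (a * b)" "a * r *\<^sub>R b = r *\<^sub>R (a * b)"
    by (simp_all add: clifford_eq_iff coef_mult sum_distrib_left mult_ac)
  have "coef (0 :: 'a clifford) {} \<noteq> coef 1 {}"
    by (simp add: coef_1)
  then show "(0 :: 'a clifford) \<noteq> 1"
    by metis
qed

end

lemma coef_mult:
  "coef (x * y) C = (\<Sum>A\<in>UNIV. reorder_sign A (sym_diff A C) * coef x A * coef y (sym_diff A C))"
  by transfer simp

lemma one_clifford_eq: "(1 :: 'n::{finite,linorder} clifford) = cbasis {}"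
  by transfer (auto simp: fun_eq_iff)

lemma cbasis_mult:
  "cbasis A * cbasis B = reorder_sign A B *\<^sub>R cbasis (sym_diff A B)"
proof (unfold clifford_eq_iff, rule allI)
  fix C
  have 1: "B = sym_diff A C \<longleftrightarrow> sym_diff A B = C" by auto
  have "coef (cbasis A * cbasis B) C =
      (\<Sum>A'\<in>UNIV. if A' = A then if sym_diff A B = C then reorder_sign A B else 0 else 0)"
    unfolding coef_mult coef_cbasis 1 [symmetric] by (intro sum.cong) (simp_all del: Un_iff)
  then show "coef (cbasis A * cbasis B) C = coef (reorder_sign A B *\<^sub>R cbasis (sym_diff A B)) C"
    by simp
qed

definition cgen :: "'n \<Rightarrow> 'n clifford" where "cgen j = cbasis {j}"

lemma cgen_square: "cgen j * cgen j = - (1 :: 'n::{finite,linorder} clifford)"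
  by (simp add: cgen_def cbasis_mult reorder_sign_def one_clifford_eq)

lemma cgen_anticommute:
  assumes "j \<noteq> k"
  shows "cgen j * cgen k + cgen k * cgen j = (0 :: 'n::{finite,linorder} clifford)"
proof -
  have "sym_diff {j} {k} = {j, k}" "sym_diff {k} {j} = {j, k}"
    using assms by auto
  then show ?thesis
    using assms by (cases j k rule: linorder_cases) (auto simp: cgen_def cbasis_mult reorder_sign_def)
qed

lemma cbasis_insert:
  assumes "\<And>a. a \<in> A \<Longrightarrow> j < a"
  shows "cbasis (insert j A) = cgen j * (cbasis A :: 'n::{finite,linorder} clifford)"
proof -
  have "sym_diff {j} A = insert j A" using assms by auto
  moreover have "reorder_sign {j} A = 1"
    using assms by (auto simp: reorder_sign_def not_le intro!: prod.neutral)
  ultimately show ?thesis by (simp add: cgen_def cbasis_mult)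
qed

lemma DIM_clifford: "DIM('n::finite clifford) = 2 ^ CARD('n)"
proof -
  have "inj (cbasis :: 'n set \<Rightarrow> 'n clifford)"
    by (rule injI) (metis coef_cbasis zero_neq_one)
  then show ?thesis
    by (simp add: Basis_clifford_def card_image card_Pow flip: Pow_UNIV)
qed

type_synonym 'n rvec = "(real, 'n) vec"
type_synonym 'n paravec = "real \<times> 'n rvec"

definition clifford_vec :: "'n::finite rvec \<Rightarrow> 'n clifford"
  where "clifford_vec x = (\<Sum>j\<in>UNIV. (x $ j) *\<^sub>R cgen j)"


section \<open>Differential operators\<close>

definition partial_deriv ::
    "'a::real_vector \<Rightarrow> ('a \<Rightarrow> 'b::real_normed_vector) \<Rightarrow> 'a \<Rightarrow> 'b"
  where "partial_deriv b f x = vector_derivative (\<lambda>t. f (x + t *\<^sub>R b)) (at 0)"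

definition laplacian ::
    "('a::euclidean_space \<Rightarrow> 'b::real_normed_vector) \<Rightarrow> 'a \<Rightarrow> 'b"
  where "laplacian f x = (\<Sum>b\<in>Basis. partial_deriv b (partial_deriv b f) x)"

definition dirac ::
    "('n::{finite,linorder} rvec \<Rightarrow> 'n clifford) \<Rightarrow> 'n rvec \<Rightarrow> 'n clifford"
  where "dirac f x = (\<Sum>j\<in>UNIV. cgen j * partial_deriv (axis j 1) f x)"

definition cauchy_riemann ::
    "('n::{finite,linorder} paravec \<Rightarrow> 'n clifford) \<Rightarrow> 'n paravec \<Rightarrow> 'n clifford"
  where "cauchy_riemann f x =
    partial_deriv (1, 0) f x + (\<Sum>j\<in>UNIV. cgen j * partial_deriv (0, axis j 1) f x)"

definition C1_on :: "'a::real_normed_vector set \<Rightarrow> ('a \<Rightarrow> 'b::real_normed_vector) \<Rightarrow> bool"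
  where "C1_on S f \<longleftrightarrow>
    (\<exists>f'. (\<forall>x\<in>S. (f has_derivative blinfun_apply (f' x)) (at x)) \<and> continuous_on S f')"

definition monogenic_on ::
    "'n::{finite,linorder} paravec set \<Rightarrow> ('n paravec \<Rightarrow> 'n clifford) \<Rightarrow> bool"
  where "monogenic_on S f \<longleftrightarrow> open S \<and> C1_on S f \<and> (\<forall>x\<in>S. cauchy_riemann f x = 0)"


section \<open>The CK-extension and the Fueter transform\<close>

text \<open>
  \<open>CK g\<close> is the Taylor series in \<open>x\<^sub>0\<close> forced by \<open>\<partial>\<^bsub>x0\<^esub> F = - dirac F\<close> and \<open>F (0, x) = g x\<close>. Where the
  series diverges, \<open>CK g\<close> is an unspecified value of \<open>suminf\<close>.
\<close>

definition CK_term ::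
    "('n::{finite,linorder} rvec \<Rightarrow> 'n clifford) \<Rightarrow> 'n paravec \<Rightarrow> nat \<Rightarrow> 'n clifford"
  where "CK_term g x n = ((- fst x) ^ n / fact n) *\<^sub>R (dirac ^^ n) g (snd x)"

definition CK ::
    "('n::{finite,linorder} rvec \<Rightarrow> 'n clifford) \<Rightarrow> 'n paravec \<Rightarrow> 'n clifford"
  where "CK g x = (\<Sum>n. CK_term g x n)"

definition monogenic_extension ::
    "('n::{finite,linorder} rvec \<Rightarrow> 'n clifford) \<Rightarrow>
     ('n paravec \<Rightarrow> 'n clifford) \<Rightarrow> bool"
  where "monogenic_extension g F \<longleftrightarrow> monogenic_on UNIV F \<and> (\<forall>x. F (0, x) = g x)"

text \<open>
  The transform \<open>Ft[f, 1]\<close>, intended for odd \<open>m\<close>. Its values at points with \<open>snd x = 0\<close> carry no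
  meaning; elsewhere they depend only on \<open>f\<close> in the upper half-plane.
\<close>

definition Ft ::
    "(complex \<Rightarrow> complex) \<Rightarrow> 'n::{finite,linorder} paravec \<Rightarrow> 'n clifford"
  where "Ft f = (laplacian ^^ ((CARD('n) - 1) div 2))
    (\<lambda>x. of_real (Re (f (Complex (fst x) (norm (snd x)))))
       + clifford_vec (snd x /\<^sub>R norm (snd x))
           * of_real (Im (f (Complex (fst x) (norm (snd x))))))"

definition gaussian :: "'n::{finite,linorder} rvec \<Rightarrow> 'n clifford"
  where "gaussian x = of_real (exp (- (norm x)\<^sup>2 / 2))"

fun dfact :: "nat \<Rightarrow> nat" where
  "dfact 0 = 1"
| "dfact (Suc 0) = 1"
| "dfact (Suc (Suc n)) = Suc (Suc n) * dfact n"

end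

theory Submission
  imports Defs "HOL-Complex_Analysis.Cauchy_Integral_Formula"
begin

text \<open>
  Everything is axially symmetric. Write \<open>t = x\<^sub>0\<close>, \<open>s = r\<^sup>2 = |x|\<^sup>2\<close>, \<open>X\<close> for the Clifford vector and
  \<open>m = 2 k + 1\<close>. An axial function \<open>a (t, s) + X b (t, s)\<close> with smooth \<open>a\<close>, \<open>b\<close> is smooth on the whole
  space, also across \<open>X = 0\<close>, and it is annihilated by the Cauchy-Riemann operator as soon as
  \<open>(a, b)\<close> solves the Vekua system
    \<open>\<partial>\<^sub>t a = \<mu> b + 2 s \<partial>\<^sub>s b\<close>,  \<open>\<partial>\<^sub>t b = - 2 \<partial>\<^sub>s a\<close>
  with \<open>\<mu> = m\<close>. For \<open>\<mu> = 1\<close> these are the Cauchy-Riemann equations of \<open>a + i r b\<close> as a function of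
  \<open>t + i r\<close>, so that \<open>exp (z\<^sup>2 / 2)\<close> gives a solution \<open>(gauss_re, gauss_im)\<close>.

  The theorem rests on one operator, \<open>radial = - 2 \<partial>\<^sub>s = - (1 / r) \<partial>\<^sub>r\<close>, and three of its properties:

    \<^item> it turns a solution for \<open>\<mu>\<close> into one for \<open>\<mu> + 2\<close> (\<open>vekua_radial\<close>), so \<open>radial ^^ k\<close> leads from
      \<open>exp (z\<^sup>2 / 2)\<close> to a monogenic function;

    \<^item> it fixes \<open>exp (- s / 2)\<close>, so that this monogenic function restricts to the Gaussian on \<open>t = 0\<close>
      (\<open>funpow_radial_gauss_re_0\<close>, \<open>funpow_radial_gauss_im_0\<close>);

    \<^item> on axial functions with \<open>(a, b)\<close> a solution for \<open>\<mu>\<close>, the Laplacian is \<open>(\<mu> - m) radial\<close>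
      (\<open>laplacian_axial_vekua\<close>), so that the Fueter transform is the same monogenic function times
      \<open>\<Prod>j<k. (1 + 2 j - m) = (- 1) ^ k (m - 1)!!\<close>.

  The CK series is the Taylor series in \<open>t\<close> of a monogenic function \<open>F\<close> that is entire in \<open>t\<close>:
  \<open>\<partial>\<^sub>t F = - dirac F\<close> and \<open>\<partial>\<^sub>t\<close> commutes with \<open>dirac\<close>, hence \<open>\<partial>\<^sub>t ^^ n F = (- 1) ^ n dirac ^^ n F\<close>.
  What has to be supplied is a space of functions of \<open>(t, s)\<close> that contains \<open>gauss_re\<close> and
  \<open>gauss_im\<close>, is closed under \<open>\<partial>\<^sub>t\<close>, \<open>\<partial>\<^sub>s\<close> and multiplication by \<open>s\<close>, has commuting mixed
  derivatives and consists of functions entire in \<open>t\<close>. Such a space is spanned by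
  \<open>t ^ a s ^ b c\<^sub>j (t\<^sup>2 s) exp ((t\<^sup>2 - s) / 2)\<close>, where \<open>c\<^sub>j\<close> is the \<open>j\<close>-th derivative of the entire function
  \<open>cos \<surd>y\<close>; passing to \<open>\<surd>y\<close> is what makes \<open>\<partial>\<^sub>s\<close>, as opposed to \<open>\<partial>\<^sub>r\<close>, harmless at \<open>r = 0\<close>. On this
  space the iterates of \<open>radial\<close> are explicit binomial sums, which at \<open>s = 0\<close> become the second
  formula of the theorem.
\<close>

section \<open>The entire function cos (sqrt y) and its derivatives\<close>

text \<open>
  \<open>cossqrt j\<close> is the \<open>j\<close>-th derivative of \<open>\<Sum>n. (- y) ^ n / (2 n)!\<close>, the entire function that equals
  \<open>cos \<surd>y\<close> for \<open>y \<ge> 0\<close>. It is polymorphic so that the real function and its holomorphic extension are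
  the same power series.
\<close>

definition cossqrt_coeff :: "nat \<Rightarrow> nat \<Rightarrow> real"
  where "cossqrt_coeff j n = (- 1) ^ (n + j) * fact (n + j) / (fact n * fact (2 * (n + j)))"

definition cossqrt :: "nat \<Rightarrow> 'a::{real_normed_field,banach} \<Rightarrow> 'a"
  where "cossqrt j y = (\<Sum>n. of_real (cossqrt_coeff j n) * y ^ n)"

lemma diffs_cossqrt_coeff:
  "diffs (\<lambda>n. of_real (cossqrt_coeff j n)) =
    (\<lambda>n. of_real (cossqrt_coeff (Suc j) n) :: 'a::{real_normed_field,banach})"
proof
  fix n
  have "real (Suc n) * cossqrt_coeff j (Suc n) = cossqrt_coeff (Suc j) n"
    by (simp add: cossqrt_coeff_def divide_simps del: of_nat_Suc)
  then show "diffs (\<lambda>n. of_real (cossqrt_coeff j n)) n = (of_real (cossqrt_coeff (Suc j) n) :: 'a)"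
    unfolding diffs_def by (metis of_real_mult of_real_of_nat_eq)
qed

lemma abs_cossqrt_coeff_le: "\<bar>cossqrt_coeff j n\<bar> \<le> 1 / fact n"
proof -
  have "fact (n + j) \<le> (fact (2 * (n + j)) :: real)"
    by (rule fact_mono) simp
  then show ?thesis
    by (simp add: cossqrt_coeff_def abs_mult power_abs divide_simps)
qed

lemma summable_cossqrt:
  "summable (\<lambda>n. of_real (cossqrt_coeff j n) * y ^ n :: 'a::{real_normed_field,banach})"
proof (rule summable_comparison_test)
  show "\<exists>N. \<forall>n\<ge>N. norm (of_real (cossqrt_coeff j n) * y ^ n) \<le> inverse (fact n) * norm y ^ n"
    using abs_cossqrt_coeff_le
    by (auto simp: norm_mult norm_power inverse_eq_divide simp del: times_divide_eq_left
      intro!: exI[of _ 0] mult_right_mono)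
  show "summable (\<lambda>n. inverse (fact n) * norm y ^ n)"
    by (rule summable_exp)
qed

lemma has_field_derivative_cossqrt:
  "(cossqrt j has_field_derivative cossqrt (Suc j) y) (at y)"
  unfolding cossqrt_def[abs_def] fun_cong[OF diffs_cossqrt_coeff, symmetric]
  by (rule termdiffs_strong_converges_everywhere) (rule summable_cossqrt)

lemma cossqrt_of_real: "cossqrt j (of_real y) = of_real (cossqrt j (y :: real))"
proof -
  have "(\<lambda>n. of_real (cossqrt_coeff j n * y ^ n) :: 'a) sums of_real (cossqrt j y)"
    unfolding cossqrt_def using summable_cossqrt[of j y]
    by (intro sums_of_real) (simp add: summable_sums)
  then show ?thesis
    by (simp add: cossqrt_def sums_iff)
qed

lemma cossqrt_0: "cossqrt j 0 = of_real (cossqrt_coeff j 0)"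
  unfolding cossqrt_def by (rule powser_zero)

text \<open>
  This is \<open>4 y c'' + 2 c' + c = 0\<close>, the equation \<open>cos'' = - cos\<close> after the substitution \<open>\<surd>y\<close>. At the
  level of coefficients, multiplying \<open>c''\<close> by \<open>y\<close> brings back the coefficients of \<open>c'\<close>, with the
  factor \<open>n\<close>.
\<close>

lemma cossqrt_ode: "cossqrt 0 y + 2 * cossqrt 1 y + 4 * y * cossqrt 2 y = 0" for y :: real
proof -
  have s: "(\<lambda>n. cossqrt_coeff j n * y ^ n) sums cossqrt j y" for j
    unfolding cossqrt_def using summable_cossqrt[of j y] by (simp add: summable_sums)
  have 2: "(\<lambda>n. real n * cossqrt_coeff 1 n * y ^ n) sums (y * cossqrt 2 y)"
  proof (rule sums_Suc_imp)
    have "(\<lambda>n. y * (cossqrt_coeff 2 n * y ^ n)) sums (y * cossqrt 2 y)"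
      by (intro sums_mult s)
    moreover have "cossqrt_coeff 2 n = real (Suc n) * cossqrt_coeff 1 (Suc n)" for n
      using fun_cong[OF diffs_cossqrt_coeff[where j = 1 and 'a = real], of n]
      by (simp add: diffs_def numeral_2_eq_2)
    ultimately show "(\<lambda>n. real (Suc n) * cossqrt_coeff 1 (Suc n) * y ^ Suc n) sums (y * cossqrt 2 y)"
      by (simp add: mult_ac)
  qed simp
  have "cossqrt_coeff 0 n + 2 * cossqrt_coeff 1 n + 4 * (real n * cossqrt_coeff 1 n) = 0" for n
    by (simp add: cossqrt_coeff_def divide_simps) (simp add: algebra_simps)
  then have "(\<lambda>n. cossqrt_coeff 0 n * y ^ n + 2 * (cossqrt_coeff 1 n * y ^ n)
      + 4 * (real n * cossqrt_coeff 1 n * y ^ n)) = (\<lambda>n. 0)"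
  proof -
    assume c: "\<And>n. cossqrt_coeff 0 n + 2 * cossqrt_coeff 1 n + 4 * (real n * cossqrt_coeff 1 n) = 0"
    have "cossqrt_coeff 0 n * y ^ n + 2 * (cossqrt_coeff 1 n * y ^ n)
        + 4 * (real n * cossqrt_coeff 1 n * y ^ n)
      = (cossqrt_coeff 0 n + 2 * cossqrt_coeff 1 n + 4 * (real n * cossqrt_coeff 1 n)) * y ^ n" for n
      by (simp add: algebra_simps)
    then show ?thesis
      by (simp only: c mult_zero_left)
  qed
  with sums_add[OF sums_add[OF s[of 0] sums_mult[OF s[of 1], of 2]] sums_mult[OF 2, of 4]]
  have "(\<lambda>n. 0::real) sums (cossqrt 0 y + 2 * cossqrt 1 y + 4 * (y * cossqrt 2 y))"
    by simp
  then show ?thesis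
    using sums_unique2[OF _ sums_zero] by (simp add: mult.assoc)
qed

lemma cossqrt_0_square: "cossqrt 0 (y\<^sup>2) = cos y" for y :: real
proof -
  have "(\<lambda>n. (- 1) ^ n / fact (2 * n) * y ^ (2 * n)) sums cos y"
    by (rule cos_paired)
  then show ?thesis
    unfolding cossqrt_def cossqrt_coeff_def
    by (intro sums_unique[symmetric]) (simp add: power_mult)
qed

lemma cossqrt_1_square: "- 2 * y * cossqrt 1 (y\<^sup>2) = sin y" for y :: real
proof -
  have "(cos has_real_derivative cossqrt 1 (y\<^sup>2) * (2 * y)) (at y)"
    unfolding cossqrt_0_square [symmetric]
    by (auto intro!: derivative_eq_intros DERIV_chain2[OF has_field_derivative_cossqrt])
  from DERIV_unique[OF this DERIV_cos] show ?thesis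
    by algebra
qed

section \<open>A function space closed under partial derivatives\<close>

lemma partial_deriv_eqI:
  assumes "(f has_derivative f') (at x)"
  shows "partial_deriv b f x = f' b"
proof -
  have "((\<lambda>t. f (x + t *\<^sub>R b)) has_derivative (\<lambda>t. f' (t *\<^sub>R b))) (at 0)"
    by (rule has_derivative_compose[where f = "\<lambda>t. x + t *\<^sub>R b" and g = f, unfolded o_def])
       (auto intro!: derivative_eq_intros assms)
  then have "((\<lambda>t. f (x + t *\<^sub>R b)) has_vector_derivative f' b) (at 0)"
    using linear_scale[OF has_derivative_linear[OF assms]] by (simp add: has_vector_derivative_def)
  then show ?thesis
    unfolding partial_deriv_def by (rule vector_derivative_at)
qed

abbreviation Dt :: "(real \<times> real \<Rightarrow> real) \<Rightarrow> real \<times> real \<Rightarrow> real"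
  where "Dt \<equiv> partial_deriv (1, 0)"

abbreviation Ds :: "(real \<times> real \<Rightarrow> real) \<Rightarrow> real \<times> real \<Rightarrow> real"
  where "Ds \<equiv> partial_deriv (0, 1)"

text \<open>
  With \<open>p = (t, s)\<close>, the case \<open>a = b = j = 0\<close> is the real part \<open>exp ((t\<^sup>2 - r\<^sup>2) / 2) cos (t r)\<close> of
  \<open>exp (z\<^sup>2 / 2)\<close> at \<open>z = t + i r\<close>, \<open>s = r\<^sup>2\<close>; the other terms arise from it by differentiation.
\<close>

definition gauss_term :: "nat \<Rightarrow> nat \<Rightarrow> nat \<Rightarrow> real \<times> real \<Rightarrow> real"
  where "gauss_term a b j p = fst p ^ a * snd p ^ b * cossqrt j ((fst p)\<^sup>2 * snd p)
    * exp (((fst p)\<^sup>2 - snd p) / 2)"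

lemmas has_derivative_cossqrt [derivative_intros] =
  has_field_derivative_cossqrt [THEN DERIV_compose_FDERIV]

definition gauss_term_t :: "nat \<Rightarrow> nat \<Rightarrow> nat \<Rightarrow> real \<times> real \<Rightarrow> real"
  where "gauss_term_t a b j p = real a * gauss_term (a - 1) b j p
     + 2 * gauss_term (a + 1) (b + 1) (j + 1) p
     + gauss_term (a + 1) b j p"

definition gauss_term_s :: "nat \<Rightarrow> nat \<Rightarrow> nat \<Rightarrow> real \<times> real \<Rightarrow> real"
  where "gauss_term_s a b j p = real b * gauss_term a (b - 1) j p + gauss_term (a + 2) b (j + 1) p
     - 1 / 2 * gauss_term a b j p"

lemma has_derivative_gauss_term:
  "(gauss_term a b j has_derivative (\<lambda>h. fst h * gauss_term_t a b j p + snd h * gauss_term_s a b j p)) (at p)"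
  unfolding gauss_term_def gauss_term_t_def gauss_term_s_def
  by (rule derivative_eq_intros refl | simp)+
     (simp add: fun_eq_iff field_simps power2_eq_square)

lemma Dt_gauss_term: "Dt (gauss_term a b j) = gauss_term_t a b j"
  by (simp add: fun_eq_iff partial_deriv_eqI[OF has_derivative_gauss_term])

lemma Ds_gauss_term: "Ds (gauss_term a b j) = gauss_term_s a b j"
  by (simp add: fun_eq_iff partial_deriv_eqI[OF has_derivative_gauss_term])

inductive gauss_span :: "(real \<times> real \<Rightarrow> real) \<Rightarrow> bool" where
  gauss_term: "gauss_span (gauss_term a b j)"
| add: "gauss_span f \<Longrightarrow> gauss_span g \<Longrightarrow> gauss_span (\<lambda>p. f p + g p)"
| scale: "gauss_span f \<Longrightarrow> gauss_span (\<lambda>p. c * f p)"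

lemma gauss_span_times_snd: "gauss_span f \<Longrightarrow> gauss_span (\<lambda>p. snd p * f p)"
proof (induction rule: gauss_span.induct)
  case (gauss_term a b j)
  have "(\<lambda>p. snd p * gauss_term a b j p) = gauss_term a (Suc b) j"
    by (simp add: fun_eq_iff gauss_term_def)
  then show ?case by (simp add: gauss_span.gauss_term)
next
  case (add f g)
  show ?case
    using gauss_span.add[OF add.IH] by (simp add: distrib_left)
next
  case (scale f c)
  show ?case
    using gauss_span.scale[OF scale.IH, of c] by (simp add: mult_ac)
qed

lemma gauss_span_has_derivative:
  assumes "gauss_span f"
  shows "(f has_derivative (\<lambda>h. fst h * Dt f p + snd h * Ds f p)) (at p)"
  using assms
proof (induction rule: gauss_span.induct)
  case (gauss_term a b j)
  show ?case unfolding Dt_gauss_term Ds_gauss_term by (rule has_derivative_gauss_term)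
next
  case (add f g)
  have d: "((\<lambda>p. f p + g p) has_derivative (\<lambda>h. (fst h * Dt f p + snd h * Ds f p)
      + (fst h * Dt g p + snd h * Ds g p))) (at p)"
    by (intro derivative_intros add)
  then show ?case
    by (auto simp: partial_deriv_eqI[OF d] algebra_simps intro: has_derivative_eq_rhs)
next
  case (scale f c)
  have d: "((\<lambda>p. c * f p) has_derivative (\<lambda>h. c * (fst h * Dt f p + snd h * Ds f p))) (at p)"
    by (intro derivative_intros scale)
  then show ?case
    by (auto simp: partial_deriv_eqI[OF d] algebra_simps intro: has_derivative_eq_rhs)
qed

lemma partial_deriv_add:
  assumes "gauss_span f" "gauss_span g"
  shows "partial_deriv b (\<lambda>p. f p + g p) = (\<lambda>p. partial_deriv b f p + partial_deriv b g p)"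
proof
  fix p
  note f = gauss_span_has_derivative[OF assms(1), of p]
  note g = gauss_span_has_derivative[OF assms(2), of p]
  show "partial_deriv b (\<lambda>p. f p + g p) p = partial_deriv b f p + partial_deriv b g p"
    by (simp only: partial_deriv_eqI[OF has_derivative_add[OF f g]]
        partial_deriv_eqI[OF f, of b] partial_deriv_eqI[OF g, of b])
qed

lemma partial_deriv_scale:
  assumes "gauss_span f"
  shows "partial_deriv b (\<lambda>p. c * f p) = (\<lambda>p. c * partial_deriv b f p)"
proof
  fix p
  note f = gauss_span_has_derivative[OF assms(1), of p]
  show "partial_deriv b (\<lambda>p. c * f p) p = c * partial_deriv b f p"
    by (simp only: partial_deriv_eqI[OF has_derivative_mult_right[OF f]] partial_deriv_eqI[OF f, of b])
qed

lemma partial_deriv_uminus: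
  "gauss_span f \<Longrightarrow> partial_deriv b (\<lambda>p. - f p) = (\<lambda>p. - partial_deriv b f p)"
  using partial_deriv_scale [of f b "- 1"] by simp

lemma partial_deriv_times_snd:
  assumes "gauss_span f"
  shows "Dt (\<lambda>p. snd p * f p) = (\<lambda>p. snd p * Dt f p)"
    and "Ds (\<lambda>p. snd p * f p) = (\<lambda>p. f p + snd p * Ds f p)"
proof -
  have "((\<lambda>p. snd p * f p) has_derivative
      (\<lambda>h. snd p * (fst h * Dt f p + snd h * Ds f p) + snd h * f p)) (at p)" for p
    using gauss_span_has_derivative[OF assms] by (intro derivative_intros)
  from partial_deriv_eqI[OF this]
  show "Dt (\<lambda>p. snd p * f p) = (\<lambda>p. snd p * Dt f p)"
    and "Ds (\<lambda>p. snd p * f p) = (\<lambda>p. f p + snd p * Ds f p)"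
    by (simp_all add: fun_eq_iff)
qed

lemma gauss_span_Dt: "gauss_span f \<Longrightarrow> gauss_span (Dt f)"
proof (induction rule: gauss_span.induct)
  case (gauss_term a b j)
  show ?case
    unfolding Dt_gauss_term gauss_term_t_def by (intro gauss_span.intros)
next
  case (add f g)
  then show ?case by (simp add: partial_deriv_add gauss_span.add)
next
  case (scale f c)
  then show ?case by (simp add: partial_deriv_scale gauss_span.scale)
qed

lemma gauss_span_Ds: "gauss_span f \<Longrightarrow> gauss_span (Ds f)"
proof (induction rule: gauss_span.induct)
  case (gauss_term a b j)
  have "gauss_span (\<lambda>p. (real b * gauss_term a (b - 1) j p + gauss_term (a + 2) b (j + 1) p)
     + (- 1 / 2) * gauss_term a b j p)"
    by (intro gauss_span.intros)
  then show ?case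
    unfolding Ds_gauss_term gauss_term_s_def by simp
next
  case (add f g)
  then show ?case by (simp add: partial_deriv_add gauss_span.add)
next
  case (scale f c)
  then show ?case by (simp add: partial_deriv_scale gauss_span.scale)
qed

lemma Dt_gauss_term_s:
  "Dt (gauss_term_s a b j) = (\<lambda>p. real b * gauss_term_t a (b - 1) j p + gauss_term_t (a + 2) b (j + 1) p
     + (- 1 / 2) * gauss_term_t a b j p)"
proof -
  have "gauss_term_s a b j = (\<lambda>p. (real b * gauss_term a (b - 1) j p + gauss_term (a + 2) b (j + 1) p)
     + (- 1 / 2) * gauss_term a b j p)"
    by (simp add: gauss_term_s_def fun_eq_iff)
  then show ?thesis
    by (simp only: partial_deriv_add partial_deriv_scale gauss_span.intros Dt_gauss_term)
qed

lemma Ds_gauss_term_t: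
  "Ds (gauss_term_t a b j) = (\<lambda>p. real a * gauss_term_s (a - 1) b j p
     + 2 * gauss_term_s (a + 1) (b + 1) (j + 1) p
     + gauss_term_s (a + 1) b j p)"
  unfolding gauss_term_t_def[abs_def]
  by (simp only: partial_deriv_add partial_deriv_scale gauss_span.intros Ds_gauss_term)

text \<open>
  By linearity it suffices to compare the expansions of the two mixed derivatives of a generator. The
  cases concern the truncated exponents \<open>a - 1\<close> and \<open>b - 1\<close>: where truncation occurs, the coefficient
  \<open>a\<close> or \<open>b\<close> of the term is zero.
\<close>

lemma Dt_Ds_commute: "gauss_span f \<Longrightarrow> Dt (Ds f) = Ds (Dt f)"
proof (induction rule: gauss_span.induct)
  case (gauss_term a b j)
  show ?case
    unfolding Dt_gauss_term Ds_gauss_term Dt_gauss_term_s Ds_gauss_term_t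
    by (cases a; cases b) (simp_all add: fun_eq_iff gauss_term_s_def gauss_term_t_def algebra_simps
      numeral_eq_Suc)
next
  case (add f g)
  then show ?case by (simp add: partial_deriv_add gauss_span_Dt gauss_span_Ds)
next
  case (scale f c)
  then show ?case by (simp add: partial_deriv_scale gauss_span_Dt gauss_span_Ds)
qed

text \<open>
  Entirety in \<open>t\<close> is what makes the Taylor series in \<open>t\<close> converge for every \<open>t\<close>, not just near \<open>0\<close>.
\<close>

lemma gauss_span_entire:
  assumes "gauss_span f"
  shows "\<exists>F. F holomorphic_on UNIV \<and> (\<forall>t. F (complex_of_real t) = of_real (f (t, s)))"
  using assms
proof (induction rule: gauss_span.induct)
  case (gauss_term a b j)
  define F where "F = (\<lambda>z. z ^ a * of_real s ^ b * cossqrt j (z\<^sup>2 * of_real s)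
    * exp ((z\<^sup>2 - complex_of_real s) / 2))"
  have "\<exists>F'. (F has_field_derivative F') (at z)" for z
    unfolding F_def
    by (rule exI) (rule derivative_eq_intros DERIV_chain2[OF has_field_derivative_cossqrt] refl | simp)+
  then have "F holomorphic_on UNIV"
    by (auto simp: holomorphic_on_def field_differentiable_def)
  moreover have "F (complex_of_real t) = of_real (gauss_term a b j (t, s))" for t
    by (simp add: F_def gauss_term_def flip: cossqrt_of_real exp_of_real)
  ultimately show ?case by blast
next
  case (add f g)
  then obtain F G where "F holomorphic_on UNIV" "G holomorphic_on UNIV"
    "\<And>t. F (complex_of_real t) = of_real (f (t, s))" "\<And>t. G (complex_of_real t) = of_real (g (t, s))"
    by blast
  then show ?case
    by (intro exI[of _ "\<lambda>z. F z + G z"]) (auto intro: holomorphic_intros)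
next
  case (scale f c)
  then obtain F where "F holomorphic_on UNIV" "\<And>t. F (complex_of_real t) = of_real (f (t, s))"
    by blast
  then show ?case
    by (intro exI[of _ "\<lambda>z. of_real c * F z"]) (auto intro: holomorphic_intros)
qed

text \<open>
  The sign is that of the CK series: for monogenic functions, \<open>- \<partial>\<^sub>t\<close> is the Dirac operator.
\<close>

definition minus_Dt :: "(real \<times> real \<Rightarrow> real) \<Rightarrow> real \<times> real \<Rightarrow> real"
  where "minus_Dt f p = - Dt f p"

lemma gauss_span_minus_Dt: "gauss_span f \<Longrightarrow> gauss_span (minus_Dt f)"
  using gauss_span.scale[OF gauss_span_Dt, of f "-1"] by (simp add: minus_Dt_def[abs_def])

text \<open>
  The Taylor series in \<open>t\<close> around \<open>0\<close>, written with the signs of the CK series.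
\<close>

lemma gauss_span_taylor:
  assumes "gauss_span f"
  shows "(\<lambda>n. (- t) ^ n / fact n * (minus_Dt ^^ n) f (0, s)) sums f (t, s)"
proof -
  obtain F where F: "F holomorphic_on UNIV" "\<And>t. F (complex_of_real t) = of_real (f (t, s))"
    using gauss_span_entire[OF assms] by blast
  have span: "gauss_span ((minus_Dt ^^ n) f)" for n
    by (induction n) (simp_all add: assms gauss_span_minus_Dt)
  \<comment> \<open>The complex derivatives of the extension restrict to the real ones.\<close>
  have *: "(deriv ^^ n) F (complex_of_real t) = of_real ((- 1) ^ n * (minus_Dt ^^ n) f (t, s))" for n t
  proof (induction n arbitrary: t)
    case 0
    show ?case by (simp add: F)
  next
    case (Suc n)
    define h where "h = (minus_Dt ^^ n) f"
    have "(deriv ^^ n) F holomorphic_on UNIV"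
      using F(1) by (rule holomorphic_higher_deriv) simp
    then have "((deriv ^^ n) F has_field_derivative deriv ((deriv ^^ n) F) (of_real t)) (at (of_real t))"
      by (rule holomorphic_derivI) simp_all
    then have 1: "((\<lambda>t. (deriv ^^ n) F (of_real t)) has_vector_derivative
        deriv ((deriv ^^ n) F) (of_real t)) (at t)"
      by (rule has_vector_derivative_real_field)
    have "((\<lambda>t. h (t, s)) has_derivative (\<lambda>x. x * Dt h (t, s))) (at t)"
      by (rule has_derivative_compose[OF _ gauss_span_has_derivative[OF span[of n, folded h_def]],
          of "\<lambda>t. (t, s)", THEN has_derivative_eq_rhs]) (auto intro!: derivative_eq_intros)
    then have "((\<lambda>t. (- 1) ^ n * h (t, s)) has_real_derivative (- 1) ^ n * Dt h (t, s)) (at t)"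
      by (intro DERIV_cmult) (simp add: has_field_derivative_def mult_commute_abs)
    then have "((\<lambda>t. complex_of_real ((- 1) ^ n * h (t, s))) has_vector_derivative
        of_real ((- 1) ^ n * Dt h (t, s))) (at t)"
      by (rule has_vector_derivative_of_real)
    then have "deriv ((deriv ^^ n) F) (of_real t) = of_real ((- 1) ^ n * Dt h (t, s))"
      using 1 unfolding Suc h_def[symmetric] by (rule vector_derivative_unique_at[rotated])
    then show ?case
      by (simp add: minus_Dt_def [of h] h_def [symmetric])
  qed
  have "(\<lambda>n. (deriv ^^ n) F 0 / fact n * (of_real t - 0) ^ n) sums F (of_real t)"
    by (rule holomorphic_power_series[where r = "\<bar>t\<bar> + 1"])
       (auto intro: holomorphic_on_subset[OF F(1)])
  moreover have "(deriv ^^ n) F 0 / fact n * (of_real t - 0) ^ n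
      = of_real ((- t) ^ n / fact n * (minus_Dt ^^ n) f (0, s))" for n
    using *[of n 0] by (simp add: power_minus[of t])
  ultimately show ?thesis
    using F(2) by (simp add: sums_of_real_iff del: of_real_divide of_real_mult)
qed

section \<open>Vekua systems\<close>

text \<open>
  In terms of \<open>r\<close>, where \<open>s = r\<^sup>2\<close>, this is \<open>- (1 / r) \<partial>\<^sub>r\<close>.
\<close>

definition radial :: "(real \<times> real \<Rightarrow> real) \<Rightarrow> real \<times> real \<Rightarrow> real"
  where "radial f p = - 2 * Ds f p"

lemma gauss_span_radial: "gauss_span f \<Longrightarrow> gauss_span (radial f)"
  unfolding radial_def[abs_def] by (intro gauss_span.scale gauss_span_Ds)

text \<open>
  The equations say that \<open>a + X b\<close> is annihilated by the Cauchy-Riemann operator in dimension \<open>\<mu>\<close>. The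
  dimension is a real parameter because it changes along the iteration of \<open>radial\<close>, while the Clifford
  algebra stays fixed.
\<close>

definition vekua :: "real \<Rightarrow> (real \<times> real \<Rightarrow> real) \<Rightarrow> (real \<times> real \<Rightarrow> real) \<Rightarrow> bool"
  where "vekua \<mu> a b \<longleftrightarrow>
    Dt a = (\<lambda>p. \<mu> * b p + 2 * (snd p * Ds b p)) \<and> Dt b = (\<lambda>p. - 2 * Ds a p)"

lemma vekua_scale:
  assumes "gauss_span a" "gauss_span b" "vekua \<mu> a b"
  shows "vekua \<mu> (\<lambda>p. c * a p) (\<lambda>p. c * b p)"
  using assms by (simp add: vekua_def partial_deriv_scale algebra_simps)

lemma vekua_Dt:
  assumes "gauss_span a" "gauss_span b" "vekua \<mu> a b"
  shows "vekua \<mu> (Dt a) (Dt b)"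
proof -
  have "Dt (Dt a) = Dt (\<lambda>p. \<mu> * b p + 2 * (snd p * Ds b p))" "Dt (Dt b) = Dt (\<lambda>p. - 2 * Ds a p)"
    using assms(3) by (simp_all add: vekua_def)
  then show ?thesis
    using assms(1,2)
    by (simp add: vekua_def partial_deriv_add partial_deriv_scale partial_deriv_uminus
      partial_deriv_times_snd Dt_Ds_commute
      gauss_span_Dt gauss_span_Ds gauss_span_times_snd gauss_span.scale)
qed

lemma vekua_minus_Dt:
  assumes "gauss_span a" "gauss_span b" "vekua \<mu> a b"
  shows "vekua \<mu> (minus_Dt a) (minus_Dt b)"
  using vekua_scale[OF _ _ vekua_Dt[OF assms], of "-1"] assms(1,2)
  by (simp add: minus_Dt_def[abs_def] gauss_span_Dt)

text \<open>
  Applying \<open>\<partial>\<^sub>s\<close> to \<open>\<mu> b + 2 s \<partial>\<^sub>s b\<close> yields \<open>(\<mu> + 2) \<partial>\<^sub>s b + 2 s \<partial>\<^sub>s\<^sup>2 b\<close>: the derivative of the factor \<open>s\<close>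
  raises the dimension by two.
\<close>

lemma vekua_Ds:
  assumes "gauss_span a" "gauss_span b" "vekua \<mu> a b"
  shows "vekua (\<mu> + 2) (Ds a) (Ds b)"
proof -
  have "Ds (Dt a) = Ds (\<lambda>p. \<mu> * b p + 2 * (snd p * Ds b p))" "Ds (Dt b) = Ds (\<lambda>p. - 2 * Ds a p)"
    using assms(3) by (simp_all add: vekua_def)
  then show ?thesis
    using assms(1,2)
    by (simp add: vekua_def partial_deriv_add partial_deriv_scale partial_deriv_uminus
      partial_deriv_times_snd Dt_Ds_commute
      gauss_span_Dt gauss_span_Ds gauss_span_times_snd gauss_span.scale algebra_simps)
qed

lemma vekua_radial:
  assumes "gauss_span a" "gauss_span b" "vekua \<mu> a b"
  shows "vekua (\<mu> + 2) (radial a) (radial b)"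
  unfolding radial_def[abs_def]
  using assms by (intro vekua_scale vekua_Ds gauss_span_Ds)

text \<open>
  \<open>gauss_im\<close> is the imaginary part of \<open>exp (z\<^sup>2 / 2)\<close> divided by \<open>r\<close>, which is even in \<open>r\<close> and thus a
  function of \<open>s\<close>.
\<close>

definition gauss_re :: "real \<times> real \<Rightarrow> real" where "gauss_re = gauss_term 0 0 0"
definition gauss_im :: "real \<times> real \<Rightarrow> real" where "gauss_im = (\<lambda>p. - 2 * gauss_term 1 0 1 p)"

lemma gauss_span_gauss: "gauss_span gauss_re" "gauss_span gauss_im"
  unfolding gauss_re_def gauss_im_def by (intro gauss_span.intros)+

text \<open>
  Multiplying by \<open>y = t\<^sup>2 s\<close> raises the exponents of \<open>t\<close> and \<open>s\<close>, so the differential equation of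
  \<open>cossqrt 0\<close> becomes a linear relation between the generators. Of the relations between them, this is
  the one that the Vekua system of \<open>exp (z\<^sup>2 / 2)\<close> needs.
\<close>

lemma gauss_term_ode: "gauss_term a b 0 p + 2 * gauss_term a b 1 p + 4 * gauss_term (a + 2) (b + 1) 2 p = 0"
proof -
  have "gauss_term a b 0 p + 2 * gauss_term a b 1 p + 4 * gauss_term (a + 2) (b + 1) 2 p =
    fst p ^ a * snd p ^ b * exp (((fst p)\<^sup>2 - snd p) / 2) *
      (cossqrt 0 ((fst p)\<^sup>2 * snd p) + 2 * cossqrt 1 ((fst p)\<^sup>2 * snd p)
        + 4 * ((fst p)\<^sup>2 * snd p) * cossqrt 2 ((fst p)\<^sup>2 * snd p))"
    by (simp add: gauss_term_def algebra_simps power_add power2_eq_square)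
  then show ?thesis by (simp only: cossqrt_ode mult_zero_right)
qed

lemma snd_times_gauss_term: "snd p * gauss_term a b j p = gauss_term a (b + 1) j p"
  by (simp add: gauss_term_def)

lemma vekua_gauss: "vekua 1 gauss_re gauss_im"
proof -
  have "Dt gauss_re p = 1 * gauss_im p + 2 * (snd p * Ds gauss_im p)" for p
    using gauss_term_ode[of 1 0 p] unfolding gauss_re_def gauss_im_def
    by (simp add: partial_deriv_scale partial_deriv_uminus gauss_span.intros
      Dt_gauss_term Ds_gauss_term gauss_term_t_def gauss_term_s_def
      right_diff_distrib distrib_left mult.left_commute[of "snd p"] snd_times_gauss_term numeral_eq_Suc)
  moreover have "Dt gauss_im p = - 2 * Ds gauss_re p" for p
    using gauss_term_ode[of 0 0 p] unfolding gauss_re_def gauss_im_def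
    by (simp add: partial_deriv_scale partial_deriv_uminus gauss_span.intros
      Dt_gauss_term Ds_gauss_term gauss_term_t_def gauss_term_s_def
      numeral_eq_Suc)
  ultimately show ?thesis by (simp add: vekua_def fun_eq_iff)
qed

lemma gauss_re_eq: "gauss_re (t, r\<^sup>2) = Re (exp ((Complex t r)\<^sup>2 / 2))"
proof -
  have "gauss_re (t, r\<^sup>2) = exp ((t\<^sup>2 - r\<^sup>2) / 2) * cossqrt 0 ((t * r)\<^sup>2)"
    by (simp add: gauss_re_def gauss_term_def power_mult_distrib)
  also have "\<dots> = Re (exp ((Complex t r)\<^sup>2 / 2))"
    by (simp only: cossqrt_0_square) (simp add: Re_exp power2_eq_square mult.commute)
  finally show ?thesis .
qed

lemma gauss_im_eq: "r * gauss_im (t, r\<^sup>2) = Im (exp ((Complex t r)\<^sup>2 / 2))"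
proof -
  have "r * gauss_im (t, r\<^sup>2) = exp ((t\<^sup>2 - r\<^sup>2) / 2) * (- 2 * (t * r) * cossqrt 1 ((t * r)\<^sup>2))"
    by (simp add: gauss_im_def gauss_term_def power_mult_distrib)
  also have "\<dots> = exp ((t\<^sup>2 - r\<^sup>2) / 2) * sin (t * r)"
    by (simp only: cossqrt_1_square)
  also have "\<dots> = Im (exp ((Complex t r)\<^sup>2 / 2))"
    by (simp add: Im_exp power2_eq_square mult.commute)
  finally show ?thesis .
qed

section \<open>Axial functions\<close>

lemma clifford_vec_add: "clifford_vec (x + y) = clifford_vec x + clifford_vec y"
  by (simp add: clifford_vec_def scaleR_left_distrib sum.distrib)

lemma clifford_vec_scaleR: "clifford_vec (c *\<^sub>R x) = c *\<^sub>R clifford_vec x"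
  by (simp add: clifford_vec_def scaleR_sum_right)

lemma clifford_vec_0: "clifford_vec 0 = 0"
  by (simp add: clifford_vec_def)

lemma clifford_vec_axis: "clifford_vec (axis j 1) = cgen j"
  by (simp add: clifford_vec_def axis_def if_distrib[of "\<lambda>c. c *\<^sub>R _"] cong: if_cong)

lemma bounded_linear_clifford_vec: "bounded_linear clifford_vec"
  unfolding linear_conv_bounded_linear [symmetric]
  by (rule linearI) (simp_all add: clifford_vec_add clifford_vec_scaleR)

lemmas has_derivative_clifford_vec [derivative_intros] =
  bounded_linear.has_derivative [OF bounded_linear_clifford_vec]

text \<open>
  In the double sum added to itself with the indices swapped, only anticommutators occur; they vanish off
  the diagonal.
\<close>

lemma clifford_vec_square:
  "clifford_vec x * clifford_vec x = - (x \<bullet> x) *\<^sub>R (1 :: 'n::{finite,linorder} clifford)"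
proof -
  let ?S = "\<Sum>j\<in>UNIV. \<Sum>k\<in>UNIV. (x $ j * x $ k) *\<^sub>R (cgen j * cgen k :: 'n clifford)"
  have S: "clifford_vec x * clifford_vec x = ?S"
    by (simp add: clifford_vec_def sum_product mult.commute)
  have S': "?S = (\<Sum>j\<in>UNIV. \<Sum>k\<in>UNIV. (x $ j * x $ k) *\<^sub>R (cgen k * cgen j))"
    by (subst sum.swap) (simp add: mult.commute)
  have "?S + ?S = (\<Sum>j\<in>UNIV. \<Sum>k\<in>UNIV. (x $ j * x $ k) *\<^sub>R (cgen j * cgen k + cgen k * cgen j))"
    by (subst (2) S') (simp only: scaleR_right_distrib sum.distrib)
  also have "\<dots> = (\<Sum>j\<in>UNIV. \<Sum>k\<in>UNIV. if j = k then (x $ j * x $ j) *\<^sub>R (- 2) else 0)"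
    by (intro sum.cong refl) (simp add: cgen_square cgen_anticommute)
  also have "\<dots> = (\<Sum>j\<in>UNIV. (x $ j * x $ j) *\<^sub>R (- 2))"
    by simp
  also have "\<dots> = (x \<bullet> x) *\<^sub>R (- 2)"
    by (simp only: inner_vec_def inner_real_def scaleR_left.sum)
  also have "\<dots> = 2 *\<^sub>R (- (x \<bullet> x) *\<^sub>R (1 :: 'n clifford))"
    by (simp only: scaleR_conv_of_real of_real_minus of_real_numeral mult_1_right mult_2 mult_2_right
        mult_minus_right minus_add_distrib)
  finally have "2 *\<^sub>R ?S = 2 *\<^sub>R (- (x \<bullet> x) *\<^sub>R (1 :: 'n clifford))"
    by (simp only: scaleR_2)
  then show ?thesis
    by (simp only: S scaleR_cancel_left) simp
qed

text \<open>
  The radius enters through \<open>x \<bullet> x\<close>, a polynomial, so that axial functions are differentiable at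
  \<open>x = 0\<close> as well.
\<close>

definition axial :: "(real \<times> real \<Rightarrow> real) \<Rightarrow> (real \<times> real \<Rightarrow> real) \<Rightarrow>
    'n::{finite,linorder} paravec \<Rightarrow> 'n clifford"
  where "axial a b q = a (fst q, snd q \<bullet> snd q) *\<^sub>R 1
    + b (fst q, snd q \<bullet> snd q) *\<^sub>R clifford_vec (snd q)"

definition axial_deriv :: "(real \<times> real \<Rightarrow> real) \<Rightarrow> (real \<times> real \<Rightarrow> real) \<Rightarrow>
    'n::{finite,linorder} paravec \<Rightarrow> 'n paravec \<Rightarrow> 'n clifford"
  where "axial_deriv a b q h = fst h *\<^sub>R axial (Dt a) (Dt b) q
    + (2 * (snd q \<bullet> snd h)) *\<^sub>R axial (Ds a) (Ds b) q
    + b (fst q, snd q \<bullet> snd q) *\<^sub>R clifford_vec (snd h)"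

lemma axial_scale: "c *\<^sub>R axial a b q = axial (\<lambda>p. c * a p) (\<lambda>p. c * b p) q"
  by (simp add: axial_def scaleR_right_distrib)

lemma axial_add: "axial a b q + axial a' b' q = axial (\<lambda>p. a p + a' p) (\<lambda>p. b p + b' p) q"
  by (simp add: axial_def scaleR_left_distrib)

lemma has_derivative_radius:
  assumes "gauss_span f"
  shows "((\<lambda>q. f (fst q, snd q \<bullet> snd q)) has_derivative
    (\<lambda>h. fst h * Dt f (fst q, snd q \<bullet> snd q)
      + 2 * (snd q \<bullet> snd h) * Ds f (fst q, snd q \<bullet> snd q))) (at (q :: real \<times> 'v::real_inner))"
  by (rule has_derivative_compose[OF _ gauss_span_has_derivative[OF assms],
        of "\<lambda>q. (fst q, snd q \<bullet> snd q)", THEN has_derivative_eq_rhs])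
     (auto intro!: derivative_eq_intros simp: inner_commute)

lemma has_derivative_axial:
  assumes "gauss_span a" "gauss_span b"
  shows "(axial a b has_derivative axial_deriv a b q) (at q)"
  unfolding axial_def[abs_def] axial_deriv_def
  by (rule derivative_eq_intros has_derivative_radius assms refl)+
     (simp add: fun_eq_iff algebra_simps)

lemma partial_deriv_axial:
  assumes "gauss_span a" "gauss_span b"
  shows "partial_deriv h (axial a b) q = axial_deriv a b q h"
  by (rule partial_deriv_eqI) (rule has_derivative_axial[OF assms])

lemma partial_deriv_axial_0:
  assumes "gauss_span a" "gauss_span b"
  shows "partial_deriv (1, 0) (axial a b) = axial (Dt a) (Dt b)"
  by (simp add: fun_eq_iff partial_deriv_axial assms axial_deriv_def clifford_vec_0)

lemma partial_deriv_axial_axis: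
  assumes "gauss_span a" "gauss_span b"
  shows "partial_deriv (0, axis j 1) (axial a b) = (\<lambda>q. (2 * (snd q $ j)) *\<^sub>R axial (Ds a) (Ds b) q
    + b (fst q, snd q \<bullet> snd q) *\<^sub>R cgen j)"
  by (simp add: fun_eq_iff partial_deriv_axial assms axial_deriv_def clifford_vec_axis inner_axis)

text \<open>
  Differentiating \<open>a\<close> and \<open>b\<close> through \<open>s\<close> contributes \<open>2 X (\<partial>\<^sub>s a + X \<partial>\<^sub>s b)\<close> with \<open>X\<^sup>2 = - s\<close>, and
  differentiating \<open>X\<close> itself contributes \<open>b\<close> times the sum of all \<open>e\<^sub>j\<^sup>2\<close>, which is \<open>- m\<close>.
\<close>

lemma dirac_sum_axial:
  fixes q :: "'n::{finite,linorder} paravec"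
  assumes "gauss_span a" "gauss_span b"
  shows "(\<Sum>j\<in>UNIV. cgen j * partial_deriv (0, axis j 1) (axial a b) q) =
    axial (\<lambda>p. - (real CARD('n) * b p + 2 * (snd p * Ds b p))) (\<lambda>p. 2 * Ds a p) q"
proof -
  have "(\<Sum>j\<in>UNIV. cgen j * partial_deriv (0, axis j 1) (axial a b) q)
      = 2 *\<^sub>R (clifford_vec (snd q) * axial (Ds a) (Ds b) q)
        - (real CARD('n) * b (fst q, snd q \<bullet> snd q)) *\<^sub>R 1"
    unfolding partial_deriv_axial_axis[OF assms] clifford_vec_def
    by (simp add: distrib_left sum.distrib sum_subtractf cgen_square sum_distrib_right scaleR_sum_right
      sum_constant_scaleR mult.commute del: sum_constant)
  also have "clifford_vec (snd q) * axial (Ds a) (Ds b) q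
      = axial (\<lambda>p. - (snd p * Ds b p)) (Ds a) q"
    by (simp add: axial_def distrib_left clifford_vec_square)
  also have "2 *\<^sub>R axial (\<lambda>p. - (snd p * Ds b p)) (Ds a) q
      - (real CARD('n) * b (fst q, snd q \<bullet> snd q)) *\<^sub>R 1
    = axial (\<lambda>p. - (real CARD('n) * b p + 2 * (snd p * Ds b p))) (\<lambda>p. 2 * Ds a p) q"
    by (simp add: axial_def algebra_simps)
  finally show ?thesis .
qed

lemma cauchy_riemann_axial:
  fixes a b :: "real \<times> real \<Rightarrow> real"
  assumes "gauss_span a" "gauss_span b" "vekua (real CARD('n)) a b"
  shows "cauchy_riemann (axial a b) (q :: 'n::{finite,linorder} paravec) = 0"
  using assms(3)
  unfolding cauchy_riemann_def dirac_sum_axial[OF assms(1,2)] partial_deriv_axial_0[OF assms(1,2)]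
  by (simp add: vekua_def axial_add) (simp add: axial_def)

text \<open>
  Since the image is again given by the pair \<open>(- \<partial>\<^sub>t a, - \<partial>\<^sub>t b)\<close>, which solves the same Vekua system, this
  can be iterated.
\<close>

lemma dirac_axial:
  fixes a b :: "real \<times> real \<Rightarrow> real"
  assumes "gauss_span a" "gauss_span b" "vekua (real CARD('n)) a b"
  shows "dirac (\<lambda>x. axial a b (t, x)) = (\<lambda>x :: 'n::{finite,linorder} rvec. axial (minus_Dt a) (minus_Dt b) (t, x))"
proof
  fix x :: "'n rvec"
  have "dirac (\<lambda>x. axial a b (t, x)) x = (\<Sum>j\<in>UNIV. cgen j * partial_deriv (0, axis j 1) (axial a b) (t, x))"
    by (simp add: dirac_def partial_deriv_def)
  also have "\<dots> = axial (minus_Dt a) (minus_Dt b) (t, x)"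
    using assms(3) unfolding dirac_sum_axial[OF assms(1,2)]
    by (simp add: vekua_def axial_def minus_Dt_def)
  finally show "dirac (\<lambda>x. axial a b (t, x)) x = axial (minus_Dt a) (minus_Dt b) (t, x)" .
qed

lemma continuous_on_gauss_span: "gauss_span f \<Longrightarrow> continuous_on S f"
  using gauss_span_has_derivative
  by (intro continuous_at_imp_continuous_on ballI) (blast intro: has_derivative_continuous)

lemma continuous_on_axial:
  assumes "gauss_span a" "gauss_span b"
  shows "continuous_on S (axial a b)"
  using has_derivative_axial[OF assms]
  by (intro continuous_at_imp_continuous_on ballI) (blast intro: has_derivative_continuous)

text \<open>
  The derivative is continuous because, by \<open>axial_deriv_def\<close>, its components are again built from axial
  functions.
\<close>

lemma C1_on_axial:
  assumes "gauss_span a" "gauss_span b"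
  shows "C1_on S (axial a b :: 'n::{finite,linorder} paravec \<Rightarrow> _)"
  unfolding C1_on_def
proof (intro exI conjI ballI)
  let ?D = "\<lambda>q :: 'n paravec. Blinfun (axial_deriv a b q)"
  have blin: "blinfun_apply (?D q) = axial_deriv a b q" for q
    by (rule bounded_linear_Blinfun_apply) (rule has_derivative_bounded_linear[OF has_derivative_axial[OF assms]])
  show "(axial a b has_derivative blinfun_apply (?D q)) (at q)" for q
    unfolding blin by (rule has_derivative_axial[OF assms])
  show "continuous_on S ?D"
  proof (rule continuous_on_blinfun_componentwise)
    fix h :: "'n paravec"
    have "continuous_on S (\<lambda>q. axial_deriv a b q h)"
      unfolding axial_deriv_def
      by (intro continuous_intros continuous_on_axial gauss_span_Dt gauss_span_Ds assms
        continuous_on_compose2[OF continuous_on_gauss_span[OF assms(2), of UNIV]]) auto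
    then show "continuous_on S (\<lambda>q. blinfun_apply (?D q) h)"
      by (simp add: blin)
  qed
qed

lemma sum_Basis_rvec: "(\<Sum>b\<in>(Basis :: 'n::finite rvec set). f b) = (\<Sum>j\<in>UNIV. f (axis j 1))"
proof -
  have "(Basis :: 'n rvec set) = range (\<lambda>j. axis j 1)"
    by (auto simp: Basis_vec_def)
  moreover have "inj (\<lambda>j :: 'n. axis j (1 :: real))"
    by (auto intro: injI simp: axis_eq_axis)
  ultimately show ?thesis using sum.reindex[of "\<lambda>j :: 'n. axis j (1 :: real)" UNIV f] by simp
qed

lemma partial_deriv_axial_axis2:
  assumes "gauss_span a" "gauss_span b"
  shows "partial_deriv (0, axis j 1) (partial_deriv (0, axis j 1) (axial a b)) q =
    (4 * (snd q $ j)\<^sup>2) *\<^sub>R axial (Ds (Ds a)) (Ds (Ds b)) q + 2 *\<^sub>R axial (Ds a) (Ds b) q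
    + (4 * (snd q $ j) * Ds b (fst q, snd q \<bullet> snd q)) *\<^sub>R cgen j"
proof -
  note assms' = gauss_span_Ds[OF assms(1)] gauss_span_Ds[OF assms(2)]
  have "((\<lambda>q. (2 * (snd q \<bullet> axis j 1)) *\<^sub>R axial (Ds a) (Ds b) q
      + b (fst q, snd q \<bullet> snd q) *\<^sub>R cgen j) has_derivative
    (\<lambda>h. (2 * (snd q \<bullet> axis j 1)) *\<^sub>R axial_deriv (Ds a) (Ds b) q h
      + (2 * (snd h \<bullet> axis j 1)) *\<^sub>R axial (Ds a) (Ds b) q
      + (fst h * Dt b (fst q, snd q \<bullet> snd q)
      + 2 * (snd q \<bullet> snd h) * Ds b (fst q, snd q \<bullet> snd q)) *\<^sub>R cgen j)) (at q)"
    by (rule derivative_eq_intros has_derivative_radius has_derivative_axial assms assms' refl)+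
       (simp add: fun_eq_iff algebra_simps)
  from partial_deriv_eqI[OF this, of "(0, axis j 1)"] show ?thesis
    unfolding partial_deriv_axial_axis[OF assms]
    by (simp add: inner_axis axial_deriv_def clifford_vec_axis power2_eq_square algebra_simps
      flip: scaleR_left_distrib)
qed

lemma laplacian_axial:
  assumes "gauss_span a" "gauss_span b"
  shows "laplacian (axial a b) (q :: 'n::{finite,linorder} paravec) =
    axial (\<lambda>p. Dt (Dt a) p + 2 * real CARD('n) * Ds a p + 4 * (snd p * Ds (Ds a) p))
      (\<lambda>p. Dt (Dt b) p + (2 * real CARD('n) + 4) * Ds b p + 4 * (snd p * Ds (Ds b) p)) q"
proof -
  have sum_prod: "(\<Sum>b\<in>Basis. f b) = f (1, 0) + (\<Sum>j\<in>UNIV. f (0, axis j 1))"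
    for f :: "'n paravec \<Rightarrow> 'n clifford"
  proof -
    have "(Basis :: 'n paravec set) = insert (1, 0) (Pair 0 ` Basis)"
      by (simp add: Basis_prod_def)
    then have "(\<Sum>b\<in>Basis. f b) = (\<Sum>b\<in>insert (1, 0) (Pair 0 ` (Basis :: 'n rvec set)). f b)"
      by (rule arg_cong)
    also have "\<dots> = f (1, 0) + (\<Sum>b\<in>Pair 0 ` (Basis :: 'n rvec set). f b)"
      by (rule sum.insert) auto
    also have "(\<Sum>b\<in>Pair 0 ` (Basis :: 'n rvec set). f b) = (\<Sum>j\<in>UNIV. f (0, axis j 1))"
      by (simp add: sum.reindex inj_on_def sum_Basis_rvec)
    finally show ?thesis .
  qed
  have "laplacian (axial a b) q = partial_deriv (1, 0) (partial_deriv (1, 0) (axial a b)) q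
      + (\<Sum>j\<in>UNIV. partial_deriv (0, axis j 1) (partial_deriv (0, axis j 1) (axial a b)) q)"
    unfolding laplacian_def sum_prod ..
  also have "partial_deriv (1, 0) (partial_deriv (1, 0) (axial a b)) q = axial (Dt (Dt a)) (Dt (Dt b)) q"
    by (simp add: partial_deriv_axial_0 assms gauss_span_Dt)
  also have "(\<Sum>j\<in>UNIV. partial_deriv (0, axis j 1) (partial_deriv (0, axis j 1) (axial a b)) q)
      = (4 * (snd q \<bullet> snd q)) *\<^sub>R axial (Ds (Ds a)) (Ds (Ds b)) q
        + (2 * real CARD('n)) *\<^sub>R axial (Ds a) (Ds b) q
        + (4 * Ds b (fst q, snd q \<bullet> snd q)) *\<^sub>R clifford_vec (snd q)"
    unfolding partial_deriv_axial_axis2[OF assms] inner_vec_def clifford_vec_def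
    by (simp add: sum.distrib sum_constant_scaleR scaleR_sum_right sum_distrib_left power2_eq_square
      mult_ac flip: scaleR_sum_left del: sum_constant)
  finally show ?thesis
    by (simp add: axial_def [of _ _ q] algebra_simps)
qed

text \<open>
  For \<open>\<mu> = m\<close> the Laplacian vanishes, because it factors through the Cauchy-Riemann operator. In
  general, the system expresses \<open>\<partial>\<^sub>t\<^sup>2\<close> by \<open>\<partial>\<^sub>s\<close> with coefficients belonging to dimension \<open>\<mu>\<close>, and what
  survives is the difference of the first-order terms.
\<close>

lemma laplacian_axial_vekua:
  assumes "gauss_span a" "gauss_span b" "vekua \<mu> a b"
  shows "laplacian (axial a b) (q :: 'n::{finite,linorder} paravec) =
    (\<mu> - real CARD('n)) *\<^sub>R axial (radial a) (radial b) q"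
proof -
  have v: "Dt b = (\<lambda>p. - 2 * Ds a p)" "Dt (Dt a) = (\<lambda>p. \<mu> * Dt b p + 2 * (snd p * Ds (Dt b) p))"
    using assms vekua_Dt[OF assms] by (simp_all add: vekua_def)
  have 1: "Dt (Dt a) p = - 2 * \<mu> * Ds a p - 4 * (snd p * Ds (Ds a) p)" for p
    unfolding v(2) by (simp add: v(1) partial_deriv_scale partial_deriv_uminus gauss_span.scale assms gauss_span_Ds)
  have 2: "Dt (Dt b) p = - (2 * \<mu> + 4) * Ds b p - 4 * (snd p * Ds (Ds b) p)" for p
    using vekua_Ds[OF assms] assms
    by (simp add: v(1) vekua_def partial_deriv_scale partial_deriv_uminus gauss_span.scale gauss_span_Ds algebra_simps)
  show ?thesis
    unfolding laplacian_axial[OF assms(1,2)] 1 2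
    by (simp add: axial_def radial_def algebra_simps)
qed

section \<open>The Gaussian\<close>

lemma radial_add:
  assumes "gauss_span f" "gauss_span g"
  shows "radial (\<lambda>p. f p + g p) = (\<lambda>p. radial f p + radial g p)"
  using assms by (simp add: fun_eq_iff radial_def partial_deriv_add algebra_simps)

lemma radial_scale:
  assumes "gauss_span f"
  shows "radial (\<lambda>p. c * f p) = (\<lambda>p. c * radial f p)"
  using assms by (simp add: fun_eq_iff radial_def partial_deriv_scale algebra_simps)

lemma gauss_span_funpow_radial: "gauss_span f \<Longrightarrow> gauss_span ((radial ^^ k) f)"
  by (induction k) (simp_all add: gauss_span_radial)

lemma gauss_span_funpow_minus_Dt: "gauss_span f \<Longrightarrow> gauss_span ((minus_Dt ^^ k) f)"
  by (induction k) (simp_all add: gauss_span_minus_Dt)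

lemma funpow_radial_scale:
  "gauss_span f \<Longrightarrow> (radial ^^ k) (\<lambda>p. c * f p) = (\<lambda>p. c * (radial ^^ k) f p)"
  by (induction k) (simp_all add: radial_scale gauss_span_funpow_radial)

lemma funpow_radial_add:
  "gauss_span f \<Longrightarrow> gauss_span g \<Longrightarrow>
    (radial ^^ k) (\<lambda>p. f p + g p) = (\<lambda>p. (radial ^^ k) f p + (radial ^^ k) g p)"
  by (induction k) (simp_all add: radial_add gauss_span_funpow_radial)

text \<open>
  Pascal's rule for the binomial expansion of \<open>(1 + c S) ^ (k + 1)\<close> applied to a sequence \<open>w\<close>, where \<open>S\<close>
  is the shift.
\<close>

lemma sum_binomial_Suc:
  fixes c :: "'a::comm_semiring_1"
  shows "(\<Sum>i\<le>Suc k. of_nat (Suc k choose i) * c ^ i * w i) =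
    (\<Sum>i\<le>k. of_nat (k choose i) * c ^ i * w i) + c * (\<Sum>i\<le>k. of_nat (k choose i) * c ^ i * w (Suc i))"
proof -
  have "(\<Sum>i\<le>k. of_nat (k choose i) * c ^ i * w i) = (\<Sum>i\<le>Suc k. of_nat (k choose i) * c ^ i * w i)"
    by (simp add: binomial_eq_0)
  also have "\<dots> = w 0 + (\<Sum>i\<le>k. of_nat (k choose Suc i) * c ^ Suc i * w (Suc i))"
    by (subst sum.atMost_Suc_shift) simp
  finally show ?thesis
    by (subst sum.atMost_Suc_shift)
       (simp add: sum.distrib sum_distrib_left distrib_left distrib_right ac_simps)
qed

text \<open>
  On the terms with \<open>b = 0\<close>, \<open>radial\<close> is \<open>1 - 2 S\<close>, where \<open>S\<close> shifts \<open>(a, j)\<close> to \<open>(a + 2, j + 1)\<close>; so its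
  powers are given by the binomial theorem.
\<close>

lemma funpow_radial_gauss_term:
  "(radial ^^ k) (gauss_term a 0 j) p =
    (\<Sum>i\<le>k. real (k choose i) * (- 2) ^ i * gauss_term (a + 2 * i) 0 (j + i) p)"
proof (induction k arbitrary: a j)
  case 0
  show ?case by simp
next
  case (Suc k)
  have "radial (gauss_term a 0 j) = (\<lambda>p. gauss_term a 0 j p + (- 2) * gauss_term (a + 2) 0 (j + 1) p)"
    by (simp add: fun_eq_iff radial_def Ds_gauss_term gauss_term_s_def)
  then have "(radial ^^ Suc k) (gauss_term a 0 j) p
      = (radial ^^ k) (gauss_term a 0 j) p + (- 2) * (radial ^^ k) (gauss_term (a + 2) 0 (j + 1)) p"
    by (simp only: funpow_Suc_right o_apply funpow_radial_add funpow_radial_scale gauss_span.intros)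
  also have "\<dots> = (\<Sum>i\<le>Suc k. real (Suc k choose i) * (- 2) ^ i * gauss_term (a + 2 * i) 0 (j + i) p)"
    unfolding Suc sum_binomial_Suc by (simp add: add.assoc)
  finally show ?case .
qed

lemma vekua_funpow_radial:
  "vekua (1 + 2 * real k) ((radial ^^ k) gauss_re) ((radial ^^ k) gauss_im)"
proof (induction k)
  case 0
  show ?case by (simp add: vekua_gauss)
next
  case (Suc k)
  from vekua_radial[OF _ _ this] show ?case
    by (simp add: gauss_span_funpow_radial gauss_span_gauss add.commute)
qed

text \<open>
  At \<open>t = 0\<close> only the term of the binomial sum without a power of \<open>t\<close> is left. In \<open>gauss_im\<close> every term
  carries such a power.
\<close>

lemma funpow_radial_gauss_re_0: "(radial ^^ k) gauss_re (0, s) = exp (- s / 2)"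
proof -
  have "(radial ^^ k) gauss_re (0, s) = (\<Sum>i\<le>k. if i = 0 then exp (- s / 2) else 0)"
    unfolding gauss_re_def funpow_radial_gauss_term
    by (rule sum.cong) (auto simp: gauss_term_def cossqrt_0 cossqrt_coeff_def)
  then show ?thesis by simp
qed

lemma funpow_radial_gauss_im_0: "(radial ^^ k) gauss_im (0, s) = 0"
  unfolding gauss_im_def
  by (subst funpow_radial_scale) (simp_all add: gauss_span.gauss_term funpow_radial_gauss_term gauss_term_def)

text \<open>
  The iterated Dirac derivatives of the Gaussian are the derivatives \<open>(- \<partial>\<^sub>t) ^^ n\<close>, at \<open>t = 0\<close>, of the
  monogenic function that extends it.
\<close>

lemma funpow_dirac_gaussian:
  assumes "CARD('n) = 2 * k + 1"
  shows "(dirac ^^ n) (gaussian :: 'n::{finite,linorder} rvec \<Rightarrow> 'n clifford) =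
    (\<lambda>x. axial ((minus_Dt ^^ n) ((radial ^^ k) gauss_re)) ((minus_Dt ^^ n) ((radial ^^ k) gauss_im)) (0, x))"
    (is "_ = (\<lambda>x. axial (?A n) (?B n) (0, x))")
proof (induction n)
  case 0
  show ?case
    by (simp add: fun_eq_iff axial_def gaussian_def funpow_radial_gauss_re_0 funpow_radial_gauss_im_0
      power2_norm_eq_inner of_real_def)
next
  case (Suc n)
  have span: "gauss_span (?A n)" "gauss_span (?B n)" for n
    by (intro gauss_span_funpow_minus_Dt gauss_span_funpow_radial gauss_span_gauss)+
  have "vekua (real CARD('n)) (?A n) (?B n)"
  proof (induction n)
    case 0
    show ?case using vekua_funpow_radial[of k] assms by (simp add: add.commute)
  next
    case (Suc n)
    then show ?case by (simp add: vekua_minus_Dt span)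
  qed
  then show ?case
    by (simp add: Suc dirac_axial span)
qed

text \<open>
  Coefficientwise in \<open>1\<close> and \<open>X\<close>, the CK series is the Taylor series in \<open>t\<close> of the monogenic function.
\<close>

lemma CK_term_gaussian_sums:
  assumes "CARD('n) = 2 * k + 1"
  shows "CK_term gaussian q sums
    axial ((radial ^^ k) gauss_re) ((radial ^^ k) gauss_im) (q :: 'n::{finite,linorder} paravec)"
    (is "_ sums axial ?A ?B q")
proof -
  let ?s = "snd q \<bullet> snd q"
  have "(\<lambda>n. (- fst q) ^ n / fact n * (minus_Dt ^^ n) ?A (0, ?s)) sums ?A (fst q, ?s)"
    "(\<lambda>n. (- fst q) ^ n / fact n * (minus_Dt ^^ n) ?B (0, ?s)) sums ?B (fst q, ?s)"
    by (intro gauss_span_taylor gauss_span_funpow_radial gauss_span_gauss)+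
  then have "(\<lambda>n. ((- fst q) ^ n / fact n * (minus_Dt ^^ n) ?A (0, ?s)) *\<^sub>R 1
      + ((- fst q) ^ n / fact n * (minus_Dt ^^ n) ?B (0, ?s)) *\<^sub>R clifford_vec (snd q)) sums axial ?A ?B q"
    unfolding axial_def by (intro sums_add bounded_linear.sums[OF bounded_linear_scaleR_left])
  moreover have "CK_term gaussian q = (\<lambda>n. ((- fst q) ^ n / fact n * (minus_Dt ^^ n) ?A (0, ?s)) *\<^sub>R 1
      + ((- fst q) ^ n / fact n * (minus_Dt ^^ n) ?B (0, ?s)) *\<^sub>R clifford_vec (snd q))"
    by (simp add: fun_eq_iff CK_term_def funpow_dirac_gaussian[OF assms] axial_def scaleR_right_distrib)
  ultimately show ?thesis by simp
qed

lemma CK_gaussian: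
  assumes "CARD('n) = 2 * k + 1"
  shows "CK gaussian = (axial ((radial ^^ k) gauss_re) ((radial ^^ k) gauss_im)
    :: 'n::{finite,linorder} paravec \<Rightarrow> 'n clifford)"
  using sums_unique[OF CK_term_gaussian_sums[OF assms]] by (simp add: fun_eq_iff CK_def)

lemma laplacian_scale_axial:
  assumes "gauss_span a" "gauss_span b" "vekua \<mu> a b"
  shows "laplacian (\<lambda>q. c *\<^sub>R axial a b q) =
    (\<lambda>q :: 'n::{finite,linorder} paravec. (c * (\<mu> - real CARD('n))) *\<^sub>R axial (radial a) (radial b) q)"
proof
  fix q :: "'n paravec"
  have "laplacian (\<lambda>q. c *\<^sub>R axial a b q) q = laplacian (axial (\<lambda>p. c * a p) (\<lambda>p. c * b p)) q"
    by (simp only: axial_scale)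
  also have "\<dots> = (\<mu> - real CARD('n)) *\<^sub>R axial (radial (\<lambda>p. c * a p)) (radial (\<lambda>p. c * b p)) q"
    by (intro laplacian_axial_vekua gauss_span.scale vekua_scale assms)
  also have "\<dots> = (c * (\<mu> - real CARD('n))) *\<^sub>R axial (radial a) (radial b) q"
    by (simp add: radial_scale assms mult.commute flip: axial_scale)
  finally show "laplacian (\<lambda>q. c *\<^sub>R axial a b q) q
      = (c * (\<mu> - real CARD('n))) *\<^sub>R axial (radial a) (radial b) q" .
qed

text \<open>
  The \<open>i\<close>-th application acts on a solution for \<open>\<mu> = 1 + 2 i\<close>; this is the origin of the factors.
\<close>

lemma funpow_laplacian_axial:
  "(laplacian ^^ j) (axial gauss_re gauss_im) =
    (\<lambda>q :: 'n::{finite,linorder} paravec. (\<Prod>i<j. 1 + 2 * real i - real CARD('n)) *\<^sub>R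
      axial ((radial ^^ j) gauss_re) ((radial ^^ j) gauss_im) q)"
proof (induction j)
  case 0
  show ?case by simp
next
  case (Suc j)
  then show ?case
    by (simp add: laplacian_scale_axial[OF _ _ vekua_funpow_radial] gauss_span_funpow_radial gauss_span_gauss)
qed

lemma prod_eq_dfact: "(\<Prod>i<k. 2 * real i - 2 * real k) = (- 1) ^ k * real (dfact (2 * k))"
proof (induction k)
  case (Suc k)
  then show ?case
    by (simp add: prod.lessThan_Suc_shift algebra_simps del: prod.lessThan_Suc)
qed simp

lemma dfact_pos: "dfact n > 0"
  by (induction n rule: dfact.induct) simp_all

text \<open>
  This holds at \<open>snd q = 0\<close> too: the unit vector in the definition of \<open>Ft\<close> is \<open>0\<close> there, in agreement
  with the vanishing of \<open>X\<close>, so the function under the Laplacian is a smooth axial function everywhere.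
\<close>

lemma Ft_gauss:
  assumes "CARD('n) = 2 * k + 1"
  shows "Ft (\<lambda>z. exp (z\<^sup>2 / 2)) (q :: 'n::{finite,linorder} paravec) =
    ((- 1) ^ k * real (dfact (2 * k))) *\<^sub>R axial ((radial ^^ k) gauss_re) ((radial ^^ k) gauss_im) q"
proof -
  have "of_real (Re (exp ((Complex (fst x) (norm (snd x)))\<^sup>2 / 2)))
       + clifford_vec (snd x /\<^sub>R norm (snd x)) * of_real (Im (exp ((Complex (fst x) (norm (snd x)))\<^sup>2 / 2)))
    = axial gauss_re gauss_im x" for x :: "'n paravec"
    by (cases "snd x = 0")
       (simp_all add: axial_def clifford_vec_scaleR clifford_vec_0 of_real_def power2_norm_eq_inner
         flip: gauss_re_eq gauss_im_eq)
  then have "Ft (\<lambda>z. exp (z\<^sup>2 / 2)) = (laplacian ^^ k) (axial gauss_re gauss_im :: 'n paravec \<Rightarrow> 'n clifford)"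
    using assms by (simp add: Ft_def)
  then show ?thesis
    using prod_eq_dfact[of k] assms by (simp add: funpow_laplacian_axial)
qed

lemma prod_odd_shift_eq:
  "(\<Prod>\<nu> = 1..n. (2 * real k + 1) - (2 * real \<nu> - 1)) = 2 ^ n * fact n * real (k choose n)"
proof (induction n)
  case (Suc n)
  have "Suc n * (k choose Suc n) = (k - n) * (k choose n)"
    by (simp only: binomial_absorption binomial_absorb_comp)
  then have "real (Suc n) * real (k choose Suc n) = (real k - real n) * real (k choose n)"
    by (metis binomial_eq_0 mult_zero_right not_le of_nat_0 of_nat_diff of_nat_mult le_SucI)
  then have absorb: "(real k - real n) * real (k choose n) = real (Suc n) * real (k choose Suc n)" ..
  have "(\<Prod>\<nu> = 1..Suc n. (2 * real k + 1) - (2 * real \<nu> - 1))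
      = 2 ^ n * fact n * real (k choose n) * (2 * (real k - real n))"
    using Suc by (simp add: right_diff_distrib)
  also have "\<dots> = 2 ^ Suc n * fact n * ((real k - real n) * real (k choose n))"
    by simp
  also have "\<dots> = 2 ^ Suc n * fact (Suc n) * real (k choose Suc n)"
    unfolding absorb by simp
  finally show ?case .
qed simp

lemma funpow_radial_gauss_re_axis:
  "(radial ^^ k) gauss_re (t, 0) = exp (t\<^sup>2 / 2) *
     (1 + (\<Sum>n = 1..k. (\<Prod>\<nu> = 1..n. (2 * real k + 1) - (2 * real \<nu> - 1)) * t ^ (2 * n) / fact (2 * n)))"
proof -
  let ?c = "\<lambda>n. (2 ^ n * fact n * real (k choose n)) * t ^ (2 * n) / fact (2 * n)"
  have "(radial ^^ k) gauss_re (t, 0) = (\<Sum>n\<le>k. exp (t\<^sup>2 / 2) * ?c n)"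
    unfolding gauss_re_def funpow_radial_gauss_term
  proof (rule sum.cong[OF refl])
    fix n
    have "(- 2) ^ n * (- 1) ^ n = (2 :: real) ^ n"
      by (simp flip: power_mult_distrib)
    then show "real (k choose n) * (- 2) ^ n * gauss_term (0 + 2 * n) 0 (0 + n) (t, 0) = exp (t\<^sup>2 / 2) * ?c n"
      by (simp add: gauss_term_def cossqrt_0 cossqrt_coeff_def divide_simps)
  qed
  also have "\<dots> = exp (t\<^sup>2 / 2) * (?c 0 + (\<Sum>n = 1..k. ?c n))"
    by (simp only: sum_distrib_left [symmetric] atMost_atLeast0 sum.atLeast_Suc_atMost[OF le0] One_nat_def)
  finally show ?thesis
    unfolding prod_odd_shift_eq by simp
qed

theorem proposition2:
  fixes m :: nat
  assumes "m = CARD('n::{finite,linorder})" and "odd m"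
  shows "(\<forall>x :: 'n paravec. summable (CK_term gaussian x))
    \<and> monogenic_extension (gaussian :: 'n rvec \<Rightarrow> 'n clifford) (CK gaussian)
    \<and> (\<forall>(x0 :: real) (x :: 'n rvec). x \<noteq> 0 \<longrightarrow>
         CK gaussian (x0, x) =
           ((- 1) ^ ((m - 1) div 2) / real (dfact (m - 1))) *\<^sub>R
             Ft (\<lambda>z. exp (z\<^sup>2 / 2)) (x0, x))
    \<and> (\<forall>x0 :: real.
         CK gaussian (x0, 0 :: 'n rvec) =
           of_real (exp (x0\<^sup>2 / 2) *
             (1 + (\<Sum>n = 1..(m - 1) div 2.
                (\<Prod>\<nu> = 1..n. real m - (2 * real \<nu> - 1)) * x0 ^ (2 * n) / fact (2 * n)))))"
proof (intro conjI allI impI)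
  obtain k where m: "m = 2 * k + 1"
    using assms(2) by (auto elim: oddE)
  then have card: "CARD('n) = 2 * k + 1"
    using assms(1) by simp
  let ?A = "(radial ^^ k) gauss_re" and ?B = "(radial ^^ k) gauss_im"
  have span: "gauss_span ?A" "gauss_span ?B"
    by (intro gauss_span_funpow_radial gauss_span_gauss)+
  show "summable (CK_term gaussian x)" for x :: "'n paravec"
    using CK_term_gaussian_sums[OF card] by (rule sums_summable)
  have "vekua (real CARD('n)) ?A ?B"
    using vekua_funpow_radial[of k] card by (simp add: add.commute)
  then show "monogenic_extension (gaussian :: 'n rvec \<Rightarrow> 'n clifford) (CK gaussian)"
    unfolding monogenic_extension_def monogenic_on_def CK_gaussian[OF card]
    using fun_cong[OF funpow_dirac_gaussian[OF card, of 0]]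
    by (simp add: C1_on_axial cauchy_riemann_axial span)
  show "CK gaussian (x0, x) = ((- 1) ^ ((m - 1) div 2) / real (dfact (m - 1))) *\<^sub>R
      Ft (\<lambda>z. exp (z\<^sup>2 / 2)) (x0, x)" for x0 and x :: "'n rvec"
  proof -
    have "(- 1) ^ k * (- 1) ^ k = (1 :: real)"
      by (simp flip: power_mult_distrib)
    then show ?thesis
      using dfact_pos[of "2 * k"] by (simp add: CK_gaussian[OF card] Ft_gauss[OF card] m)
  qed
  show "CK gaussian (x0, 0 :: 'n rvec) = of_real (exp (x0\<^sup>2 / 2) *
      (1 + (\<Sum>n = 1..(m - 1) div 2.
        (\<Prod>\<nu> = 1..n. real m - (2 * real \<nu> - 1)) * x0 ^ (2 * n) / fact (2 * n))))" for x0
    using funpow_radial_gauss_re_axis[of k x0]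
    by (simp add: CK_gaussian[OF card] axial_def clifford_vec_0 m of_real_def add.commute)
qed

end
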